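(* There exists a mean-payoff game $G$ such that the sequence of requirements $(\lambda_n)_{n\in\mathbb{N}}$ defined by $\lambda_n=\mathsf{nego}^n(\lambda_0)$ is not eventually constant.
   Context: A game is a tuple $G=(\Pi,V,(V_i)_{i\in\Pi},E,\mu)$ with finite player set $\Pi$, directed graph $(V,E)$ in which every vertex has an outgoing edge, partition $(V_i)_{i\in\Pi}$ of $V$ ($V_i$ = vertices of player $i$), and payoff $\mu:V^\omega\to\mathbb{R}^\Pi$. $G$ is a mean-payoff game if $V$ is finite and there are reward functions $r_i:E\to\mathbb{Q}$ such that $\mu_i(\rho)=\liminf_{n\to\infty}\frac1n\sum_{k=0}^{n-1}r_i(\rho_k\rho_{k+1})$ for every play $\rho$. Strategies, profiles, outcomes $\langle\bar\sigma\rangle$ and $\bar\sigma_{\|hv}$ (the profile from $v$ with $\sigma_{j\|hv}(h')=\sigma_j(hh')$) are as usual; $-i=\Pi\setminus\{i\}$. A requirement is a map $\lambda:V\to\overline{\mathbb{R}}$. A play $\rho$ is $\lambda$-consistent if for all $i$, $n$ with $\rho_n\in V_i$, $\mu_i(\rho_{\ge n})\ge\lambda(\rho_n)$. For $v\in V_i$, a profile $\bar\sigma_{-i}$ from $v$ is $\lambda$-rational if there is a strategy $\sigma_i$ such that, with $\bar\sigma=(\bar\sigma_{-i},\sigma_i)$, for every history $hu$ from $v$ compatible with $\bar\sigma_{-i}$, the play $\langle\bar\sigma_{\|hu}\rangle$ is $\lambda$-consistent; $\lambda\mathsf{Rat}(v)$ is the set of such profiles. The negotiation function is $\mathsf{nego}(\lambda)(v)=\inf_{\bar\sigma_{-i}\in\lambda\mathsf{Rat}(v)}\sup_{\sigma_i}\mu_i(\langle\bar\sigma_{-i},\sigma_i\rangle)$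 for $v\in V_i$, with $\inf\emptyset=+\infty$. The vacuous requirement $\lambda_0$ is constantly $-\infty$. *)

theory Defs
  imports "HOL-Analysis.Analysis"
begin

text \<open>Games with vertices and players encoded as natural numbers.
  The partition of V is given by an owner function.\<close>

record game =
  players :: "nat set"
  verts :: "nat set"
  owner :: "nat \<Rightarrow> nat"
  edges :: "(nat \<times> nat) set"
  reward :: "nat \<Rightarrow> nat \<times> nat \<Rightarrow> rat"

definition mean_payoff_game :: "game \<Rightarrow> bool" where
  "mean_payoff_game G \<longleftrightarrow> finite (players G) \<and> finite (verts G)
     \<and> edges G \<subseteq> verts G \<times> verts G
     \<and> (\<forall>v\<in>verts G. \<exists>w. (v, w) \<in> edges G)
     \<and> (\<forall>v\<in>verts G. owner G v \<in> players G)"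

definition is_hist :: "game \<Rightarrow> nat list \<Rightarrow> bool" where
  "is_hist G h \<longleftrightarrow> h \<noteq> [] \<and> set h \<subseteq> verts G
     \<and> (\<forall>k. Suc k < length h \<longrightarrow> (h ! k, h ! Suc k) \<in> edges G)"

definition strategy :: "game \<Rightarrow> nat \<Rightarrow> (nat list \<Rightarrow> nat) \<Rightarrow> bool" where
  "strategy G i \<sigma> \<longleftrightarrow> (\<forall>h. is_hist G h \<and> owner G (last h) = i \<longrightarrow> (last h, \<sigma> h) \<in> edges G)"

text \<open>A profile of the players other than i (component i is ignored).\<close>
definition profile_minus :: "game \<Rightarrow> nat \<Rightarrow> (nat \<Rightarrow> nat list \<Rightarrow> nat) \<Rightarrow> bool" where
  "profile_minus G i \<sigma>s \<longleftrightarrow> (\<forall>j\<in>players G - {i}. strategy G j (\<sigma>s j))"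

fun outpref :: "game \<Rightarrow> (nat \<Rightarrow> nat list \<Rightarrow> nat) \<Rightarrow> nat \<Rightarrow> nat \<Rightarrow> nat list" where
  "outpref G \<sigma>s v 0 = [v]"
| "outpref G \<sigma>s v (Suc k) =
     (let h = outpref G \<sigma>s v k in h @ [\<sigma>s (owner G (last h)) h])"

definition outcome :: "game \<Rightarrow> (nat \<Rightarrow> nat list \<Rightarrow> nat) \<Rightarrow> nat \<Rightarrow> nat \<Rightarrow> nat" where
  "outcome G \<sigma>s v k = last (outpref G \<sigma>s v k)"

text \<open>Mean payoff of player i (liminf of averages; finite for finite games).\<close>
definition mp :: "game \<Rightarrow> nat \<Rightarrow> (nat \<Rightarrow> nat) \<Rightarrow> ereal" where
  "mp G i \<rho> = liminf (\<lambda>n. ereal ((\<Sum>k<n. real_of_rat (reward G i (\<rho> k, \<rho> (Suc k)))) / real n))"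

definition consistent :: "game \<Rightarrow> (nat \<Rightarrow> ereal) \<Rightarrow> (nat \<Rightarrow> nat) \<Rightarrow> bool" where
  "consistent G req \<rho> \<longleftrightarrow> (\<forall>n. mp G (owner G (\<rho> n)) (\<lambda>k. \<rho> (n + k)) \<ge> req (\<rho> n))"

definition compatible :: "game \<Rightarrow> nat \<Rightarrow> (nat \<Rightarrow> nat list \<Rightarrow> nat) \<Rightarrow> nat \<Rightarrow> nat list \<Rightarrow> bool" where
  "compatible G i \<sigma>s v h \<longleftrightarrow> is_hist G h \<and> hd h = v
     \<and> (\<forall>k. Suc k < length h \<longrightarrow> owner G (h ! k) \<noteq> i
            \<longrightarrow> h ! Suc k = \<sigma>s (owner G (h ! k)) (take (Suc k) h))"

text \<open>Residual profile after history hu: the profile from u with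
  sigma_j(h') = sigma_j(h h'), where hu = h @ [u] and h' starts at u.\<close>
definition shift_profile :: "(nat \<Rightarrow> nat list \<Rightarrow> nat) \<Rightarrow> nat list \<Rightarrow> (nat \<Rightarrow> nat list \<Rightarrow> nat)" where
  "shift_profile \<sigma>s hu = (\<lambda>j h'. \<sigma>s j (butlast hu @ h'))"

definition rational :: "game \<Rightarrow> (nat \<Rightarrow> ereal) \<Rightarrow> nat \<Rightarrow> (nat \<Rightarrow> nat list \<Rightarrow> nat) \<Rightarrow> bool" where
  "rational G req v \<sigma>s \<longleftrightarrow> (let i = owner G v in
     \<exists>\<sigma>i. strategy G i \<sigma>i \<and>
       (\<forall>hu. compatible G i \<sigma>s v hu \<longrightarrow>
          consistent G req (outcome G (shift_profile (\<sigma>s(i := \<sigma>i)) hu) (last hu))))"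

definition lamRat :: "game \<Rightarrow> (nat \<Rightarrow> ereal) \<Rightarrow> nat \<Rightarrow> (nat \<Rightarrow> nat list \<Rightarrow> nat) set" where
  "lamRat G req v = {\<sigma>s. profile_minus G (owner G v) \<sigma>s \<and> rational G req v \<sigma>s}"

text \<open>Negotiation function (set to -infinity outside V, irrelevant).\<close>
definition nego :: "game \<Rightarrow> (nat \<Rightarrow> ereal) \<Rightarrow> (nat \<Rightarrow> ereal)" where
  "nego G req v = (if v \<in> verts G then
     (let i = owner G v in
       INF \<sigma>s \<in> lamRat G req v. SUP \<sigma>i \<in> {\<sigma>i. strategy G i \<sigma>i}.
          mp G i (outcome G (\<sigma>s(i := \<sigma>i)) v))
     else -\<infinity>)"

definition lam0 :: "nat \<Rightarrow> ereal" where
  "lam0 = (\<lambda>_. -\<infinity>)"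

end

theory Submission
  imports Defs
begin

text \<open>Take two players \<open>0\<close>, \<open>1\<close> with one vertex each, who may pass the move to and fro or enter
  a basin of their own, where a neutral third player chooses the frequencies of two vertices. Plays
  ending in the basin of player \<open>j\<close> pay \<open>x\<close> to \<open>j\<close> and \<open>1 + x / 2\<close> to the opponent, with
  \<open>0 \<le> x \<le> 2\<close>; passing forever pays \<open>2\<close> to both. A player \<open>i\<close> who always passes is
  either passed back forever or ends in the basin of \<open>j\<close> after a history at which the
  requirement of \<open>j\<close> had to be met, so \<open>nego \<lambda> i \<ge> 1 + \<lambda> j / 2\<close>. A fixed point must
  therefore be at least \<open>2\<close> at both vertices. On the other hand, requirements below \<open>2\<close> can be
  met by a frequency with \<open>x < 2\<close>, so that all iterates stay strictly below \<open>2\<close>.\<close>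

subsection \<open>Mean payoffs\<close>

text \<open>The two averages differ by the telescoping term \<open>(x n - x 0) / n\<close>, which
  vanishes for bounded \<open>x\<close>.\<close>

lemma liminf_mean_Suc:
  fixes x :: "nat \<Rightarrow> real"
  assumes "\<And>k. \<bar>x k\<bar> \<le> C"
  shows "liminf (\<lambda>n. ereal ((\<Sum>k<n. x (Suc k)) / real n)) = liminf (\<lambda>n. ereal ((\<Sum>k<n. x k) / real n))"
proof -
  have "(\<lambda>n. (x n - x 0) / real n) \<longlonglongrightarrow> 0"
  proof (rule Lim_null_comparison)
    have "\<bar>x n - x 0\<bar> \<le> 2 * C" for n
      using assms[of n] assms[of 0] by linarith
    then show "\<forall>\<^sub>F n in sequentially. norm ((x n - x 0) / real n) \<le> 2 * C / real n"
      by (intro always_eventually) (auto simp: divide_right_mono)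
    show "(\<lambda>n. 2 * C / real n) \<longlonglongrightarrow> 0"
      by (rule lim_const_over_n)
  qed
  then have lim: "(\<lambda>n. ereal ((x n - x 0) / real n)) \<longlonglongrightarrow> ereal 0"
    by simp
  have "(\<Sum>k<n. x (Suc k)) / real n = (x n - x 0) / real n + (\<Sum>k<n. x k) / real n" for n
    using sum_lessThan_telescope[of x n]
    by (simp add: sum_subtractf flip: add_divide_distrib)
  then show ?thesis
    using ereal_liminf_lim_add[OF lim, of "\<lambda>n. ereal ((\<Sum>k<n. x k) / real n)"] by simp
qed

text \<open>Prefix independence: with it, consistency of a play compares all requirements met on the
  way with a single payoff per player.\<close>

lemma mp_shift:
  assumes "\<And>e. \<bar>real_of_rat (reward G i e)\<bar> \<le> C"
  shows "mp G i (\<lambda>k. \<rho> (n + k)) = mp G i \<rho>"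
proof (induction n)
  case (Suc n)
  have "mp G i (\<lambda>k. \<rho> (n + Suc k)) = mp G i (\<lambda>k. \<rho> (n + k))"
    using liminf_mean_Suc[of "\<lambda>k. real_of_rat (reward G i (\<rho> (n + k), \<rho> (n + Suc k)))" C] assms
    by (simp add: mp_def)
  with Suc show ?case
    by simp
qed simp

text \<open>The value \<open>a\<close> occurs once in any \<open>p\<close> consecutive indices. The
  phase \<open>s\<close> absorbs the length of whatever precedes the play.\<close>

lemma mean_periodic_lim:
  fixes p s :: nat and a b :: real
  assumes "p > 0"
  shows "(\<lambda>n. (\<Sum>k<n. if p dvd Suc (k + s) then a else b) / real n) \<longlonglongrightarrow> b - (b - a) / p"
proof -
  \<comment> \<open>The deviation of the summand from its mean is the increment of the bounded function \<open>g\<close>.\<close>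
  define g where "g k = (b - a) / p * real ((k + s) mod p)" for k
  have step: "(if p dvd Suc (k + s) then a else b) = (b - (b - a) / p) + (g (Suc k) - g k)" for k
  proof -
    define d m where "d = (b - a) / p" and "m = (k + s) mod p"
    have d: "d * real p = b - a"
      using assms by (simp add: d_def)
    have dvd: "p dvd Suc (k + s) \<longleftrightarrow> Suc m = p"
      by (simp add: m_def dvd_eq_mod_eq_0 mod_Suc)
    have g: "g k = d * real m" "g (Suc k) = d * real (if Suc m = p then 0 else Suc m)"
      by (simp_all add: g_def d_def m_def mod_Suc)
    show ?thesis
    proof (cases "Suc m = p")
      case True
      then have "real p = real m + 1"
        by simp
      with d True show ?thesis
        unfolding dvd g d_def[symmetric] by (simp add: algebra_simps)
    next
      case False
      then show ?thesis
        unfolding dvd g d_def[symmetric] by (simp add: algebra_simps)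
    qed
  qed
  have sum: "(\<Sum>k<n. if p dvd Suc (k + s) then a else b) = real n * (b - (b - a) / p) + (g n - g 0)" for n
    unfolding step sum.distrib sum_lessThan_telescope by simp
  have "(\<lambda>n. (g n - g 0) / real n) \<longlonglongrightarrow> 0"
  proof (rule Lim_null_comparison)
    have "\<bar>g n\<bar> \<le> \<bar>b - a\<bar>" for n
    proof -
      have "real ((n + s) mod p) \<le> real p"
        using assms by (simp add: less_imp_le)
      then have "\<bar>b - a\<bar> * real ((n + s) mod p) \<le> \<bar>b - a\<bar> * real p"
        by (rule mult_left_mono) simp
      then show ?thesis
        using assms by (simp add: g_def abs_mult pos_divide_le_eq)
    qed
    note g = this
    have "\<bar>g n - g 0\<bar> \<le> 2 * \<bar>b - a\<bar>" for n
      unfolding mult_2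
      using abs_triangle_ineq4[of "g n" "g 0"] g[of n] g[of 0] by (meson add_mono order_trans)
    then show "\<forall>\<^sub>F n in sequentially. norm ((g n - g 0) / real n) \<le> 2 * \<bar>b - a\<bar> / real n"
      by (intro always_eventually) (auto simp: divide_right_mono)
    show "(\<lambda>n. 2 * \<bar>b - a\<bar> / real n) \<longlonglongrightarrow> 0"
      by (rule lim_const_over_n)
  qed
  then have "(\<lambda>n. (b - (b - a) / p) + (g n - g 0) / real n) \<longlonglongrightarrow> (b - (b - a) / p) + 0"
    by (intro tendsto_intros)
  moreover have "\<forall>\<^sub>F n in sequentially. (b - (b - a) / p) + (g n - g 0) / real n
      = (\<Sum>k<n. if p dvd Suc (k + s) then a else b) / real n"
    using eventually_gt_at_top[of 0]
    by eventually_elim (simp add: sum add_divide_distrib diff_divide_distrib)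
  ultimately show ?thesis
    by (simp add: tendsto_cong)
qed

text \<open>An increasing affine map commutes with \<open>liminf\<close>, so the link between the
  two payoffs survives even when the averages do not converge.\<close>

lemma mp_affine:
  assumes "\<And>k. real_of_rat (reward G i (\<rho> k, \<rho> (Suc k)))
      = 1 + real_of_rat (reward G j (\<rho> k, \<rho> (Suc k))) / 2"
  shows "mp G i \<rho> = 1 + ereal (1/2) * mp G j \<rho>"
proof -
  define S where "S n = (\<Sum>k<n. real_of_rat (reward G j (\<rho> k, \<rho> (Suc k)))) / real n" for n
  \<comment> \<open>At \<open>n = 0\<close> the left side is \<open>0 / 0 = 0\<close> and the right
    side is \<open>1\<close>, so the identity holds only eventually.\<close>
  have "(\<Sum>k<n. real_of_rat (reward G i (\<rho> k, \<rho> (Suc k)))) / real n = 1 + 1/2 * S n" if "n > 0" for n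
    using that by (simp add: assms sum.distrib S_def field_simps flip: sum_divide_distrib)
  then have "\<forall>\<^sub>F n in sequentially. ereal ((\<Sum>k<n. real_of_rat (reward G i (\<rho> k, \<rho> (Suc k)))) / real n)
      = 1 + ereal (1/2) * ereal (S n)"
    by (intro eventually_mono[OF eventually_gt_at_top[of 0]]) (simp add: one_ereal_def)
  then have "mp G i \<rho> = liminf (\<lambda>n. 1 + ereal (1/2) * ereal (S n))"
    unfolding mp_def by (rule Liminf_eq)
  also have "\<dots> = 1 + ereal (1/2) * liminf (\<lambda>n. ereal (S n))"
    by (simp add: Liminf_add_ereal_left Liminf_ereal_mult_left del: times_ereal.simps)
  finally show ?thesis
    by (simp add: mp_def S_def)
qed

lemma mp_const:
  assumes "\<And>k. real_of_rat (reward G i (\<rho> k, \<rho> (Suc k))) = c"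
  shows "mp G i \<rho> = ereal c"
proof -
  have "(\<lambda>n. ereal ((\<Sum>k<n. real_of_rat (reward G i (\<rho> k, \<rho> (Suc k)))) / real n)) \<longlonglongrightarrow> ereal c"
    using mean_periodic_lim[of 1 0 c c] by (simp add: assms)
  then show ?thesis
    unfolding mp_def by (rule lim_imp_Liminf[rotated]) simp
qed

subsection \<open>Outcomes\<close>

lemma length_outpref [simp]: "length (outpref G \<sigma>s v k) = Suc k"
  by (induction k) (simp_all add: Let_def)

lemma outpref_not_Nil [simp]: "outpref G \<sigma>s v k \<noteq> []"
  by (metis length_outpref length_0_conv nat.distinct(1))

lemma outcome_0 [simp]: "outcome G \<sigma>s v 0 = v"
  by (simp add: outcome_def)

lemma last_outpref: "last (outpref G \<sigma>s v k) = outcome G \<sigma>s v k"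
  by (simp add: outcome_def)

lemma outcome_Suc:
  "outcome G \<sigma>s v (Suc k) = \<sigma>s (owner G (outcome G \<sigma>s v k)) (outpref G \<sigma>s v k)"
  by (simp add: outcome_def Let_def)

lemma outpref_Suc: "outpref G \<sigma>s v (Suc k) = outpref G \<sigma>s v k @ [outcome G \<sigma>s v (Suc k)]"
  by (simp add: outcome_def Let_def)

lemma take_outpref: "k \<le> n \<Longrightarrow> take (Suc k) (outpref G \<sigma>s v n) = outpref G \<sigma>s v k"
  by (induction n) (auto simp: le_Suc_eq outpref_Suc simp del: outpref.simps(2))

lemma nth_outpref:
  assumes "k \<le> n"
  shows "outpref G \<sigma>s v n ! k = outcome G \<sigma>s v k"
proof -
  have "outpref G \<sigma>s v n ! k = last (take (Suc k) (outpref G \<sigma>s v n))"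
    using assms by (simp add: take_Suc_conv_app_nth)
  with assms show ?thesis
    by (simp add: take_outpref outcome_def)
qed

lemma is_hist_snoc:
  assumes "is_hist G h" "(last h, w) \<in> edges G" "w \<in> verts G"
  shows "is_hist G (h @ [w])"
proof -
  have h: "h \<noteq> []" "\<And>k. Suc k < length h \<Longrightarrow> (h ! k, h ! Suc k) \<in> edges G"
    using assms(1) by (simp_all add: is_hist_def)
  have "((h @ [w]) ! k, (h @ [w]) ! Suc k) \<in> edges G" if "k < length h" for k
  proof (cases "Suc k < length h")
    case True
    then show ?thesis
      using h(2) by (simp add: nth_append)
  next
    case False
    then have "length h = Suc k"
      using that by simp
    then show ?thesis
      using h(1) assms(2) by (simp add: nth_append last_conv_nth)
  qed
  then show ?thesis
    using assms by (simp add: is_hist_def)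
qed

lemma is_hist_outpref:
  assumes "mean_payoff_game G" "v \<in> verts G" "\<And>j. j \<in> players G \<Longrightarrow> strategy G j (\<sigma>s j)"
  shows "is_hist G (outpref G \<sigma>s v k)"
proof (induction k)
  case 0
  then show ?case
    using assms by (simp add: is_hist_def)
next
  case (Suc k)
  let ?h = "outpref G \<sigma>s v k"
  have "last ?h \<in> verts G"
    using Suc by (auto simp: is_hist_def)
  then have "owner G (last ?h) \<in> players G"
    using assms(1) by (simp add: mean_payoff_game_def)
  then have "(last ?h, \<sigma>s (owner G (last ?h)) ?h) \<in> edges G"
    using assms(3) Suc by (auto simp: strategy_def)
  moreover have "edges G \<subseteq> verts G \<times> verts G"
    using assms(1) by (simp add: mean_payoff_game_def)
  ultimately show ?case
    using Suc by (auto simp: Let_def intro!: is_hist_snoc)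
qed

lemma outcome_edge:
  assumes "mean_payoff_game G" "v \<in> verts G" "\<And>j. j \<in> players G \<Longrightarrow> strategy G j (\<sigma>s j)"
  shows "(outcome G \<sigma>s v k, outcome G \<sigma>s v (Suc k)) \<in> edges G"
  using is_hist_outpref[OF assms, where k = "Suc k"]
  unfolding is_hist_def
  by (metis length_outpref lessI nth_outpref order_refl le_SucI)

lemma compatible_outpref:
  assumes "mean_payoff_game G" "v \<in> verts G" "profile_minus G i \<sigma>s" "strategy G i \<sigma>i"
  shows "compatible G i \<sigma>s v (outpref G (\<sigma>s(i := \<sigma>i)) v n)"
proof -
  let ?\<sigma> = "\<sigma>s(i := \<sigma>i)"
  have "is_hist G (outpref G ?\<sigma> v n)"
    by (rule is_hist_outpref) (use assms in \<open>auto simp: profile_minus_def\<close>)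
  moreover have "hd (outpref G ?\<sigma> v n) = v"
    using nth_outpref[of 0 n G ?\<sigma> v] by (simp add: hd_conv_nth)
  ultimately show ?thesis
    by (auto simp: compatible_def nth_outpref take_outpref outcome_Suc)
qed

subsection \<open>The game\<close>

text \<open>Vertex \<open>i < 2\<close> belongs to player \<open>i\<close>, who may move to the other such vertex or into the
  basin \<open>{2 + i, 4 + i}\<close>. A basin is never left and is run by player 2, who is never paid anything.
  Rewards depend on the source of an edge: in the basin of player \<open>j\<close> the vertices \<open>2 + j\<close> and \<open>4 + j\<close>
  pay \<open>0\<close> and \<open>2\<close> to player \<open>j\<close>, but \<open>1\<close> and \<open>2\<close> to player \<open>1 - j\<close>.\<close>

definition basin_game :: game where
  "basin_game = \<lparr>players = {0, 1, 2}, verts = {..<6}, owner = (\<lambda>v. if v < 2 then v else 2),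
     edges = {(v, w). v < 6 \<and> w < 6 \<and> (v + w = 1 \<or> 2 \<le> w \<and> v mod 2 = w mod 2)},
     reward = (\<lambda>q (v, w). if q \<ge> 2 \<or> v = 2 + q then 0 else if v = 3 - q then 1 else 2)\<rparr>"

lemma basin_game_simps [simp]:
  "players basin_game = {0, 1, 2}"
  "verts basin_game = {..<6}"
  "owner basin_game v = (if v < 2 then v else 2)"
  "(v, w) \<in> edges basin_game \<longleftrightarrow> v < 6 \<and> w < 6 \<and> (v + w = 1 \<or> 2 \<le> w \<and> v mod 2 = w mod 2)"
  "reward basin_game q (v, w) = (if q \<ge> 2 \<or> v = 2 + q then 0 else if v = 3 - q then 1 else 2)"
  by (simp_all add: basin_game_def)

lemma mean_payoff_basin_game: "mean_payoff_game basin_game"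
  unfolding mean_payoff_game_def
proof (intro conjI ballI)
  fix v
  assume "v \<in> verts basin_game"
  then show "\<exists>w. (v, w) \<in> edges basin_game"
    by (intro exI[of _ "2 + v mod 2"]) auto
qed auto

lemma mp_basin_game_shift: "mp basin_game q (\<lambda>k. \<rho> (n + k)) = mp basin_game q \<rho>"
proof (rule mp_shift)
  fix e
  show "\<bar>real_of_rat (reward basin_game q e)\<bar> \<le> 2"
    by (cases e) simp
qed

lemma mp_basin_game_nonneg: "0 \<le> mp basin_game q \<rho>"
  unfolding mp_def
proof (intro Liminf_bounded always_eventually allI)
  fix n
  have "0 \<le> (\<Sum>k<n. real_of_rat (reward basin_game q (\<rho> k, \<rho> (Suc k))))"
    by (rule sum_nonneg) simp
  then show "0 \<le> ereal ((\<Sum>k<n. real_of_rat (reward basin_game q (\<rho> k, \<rho> (Suc k)))) / real n)"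
    by (simp only: ereal_less_eq zero_ereal_def divide_nonneg_nonneg of_nat_0_le_iff)
qed

lemma mp_basin_game_2: "mp basin_game 2 \<rho> = 0"
  using mp_const[of basin_game 2 \<rho> 0] by (simp add: zero_ereal_def)

subsection \<open>Upper bound\<close>

text \<open>The play settles in the basin of \<open>c\<close> and meets the low vertex
  \<open>2 + c\<close> once every \<open>p\<close> steps. The payoffs are
  \<open>x = 2 - 2 / p\<close> and \<open>1 + x / 2 = 2 - 1 / p\<close>.\<close>

lemma mp_mixing:
  assumes "c < 2" "p > 0"
    and \<rho>: "\<And>k. N \<le> k \<Longrightarrow> \<rho> (Suc k) = (if p dvd Suc (k + s) then 2 else 4) + c"
  shows "mp basin_game c \<rho> = ereal (2 - 2 / p)" "mp basin_game (1 - c) \<rho> = ereal (2 - 1 / p)"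
proof -
  have \<rho>': "\<rho> (Suc N + k) = (if p dvd Suc (k + (N + s)) then 2 else 4) + c" for k
    using \<rho>[of "N + k"] by (simp add: add.assoc add.left_commute)
  \<comment> \<open>Rewards depend on the source of an edge and \<open>\<rho>\<close> is prescribed
    only from \<open>Suc N\<close> on, so the averages are taken from there.\<close>
  have mp: "mp basin_game q (\<lambda>k. \<rho> (Suc N + k)) = ereal (2 - (2 - a) / p)"
    if "\<And>k. real_of_rat (reward basin_game q (\<rho> (Suc N + k), \<rho> (Suc N + Suc k)))
          = (if p dvd Suc (k + (N + s)) then a else 2)" for q a
    using mean_periodic_lim[OF \<open>p > 0\<close>, where a = a and b = 2 and s = "N + s"]
    unfolding mp_def that by (intro lim_imp_Liminf tendsto_ereal trivial_limit_sequentially)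
  have "real_of_rat (reward basin_game c ((if b then 2 else 4) + c, w)) = (if b then 0 else 2)"
    "real_of_rat (reward basin_game (1 - c) ((if b then 2 else 4) + c, w)) = (if b then 1 else 2)" for b w
    using \<open>c < 2\<close> by (cases b; cases "c = 0"; simp)+
  note reward = this[of "p dvd Suc (k + (N + s))" for k, folded \<rho>']
  show "mp basin_game c \<rho> = ereal (2 - 2 / p)"
    using mp[of c 0, OF reward(1)] unfolding mp_basin_game_shift[of _ \<rho>] by simp
  show "mp basin_game (1 - c) \<rho> = ereal (2 - 1 / p)"
    using mp[of "1 - c" 1, OF reward(2)] unfolding mp_basin_game_shift[of _ \<rho>] by simp
qed

lemma four_add_mod_2: "(4 + n mod 2) mod 2 = n mod (2 :: nat)"
  by presburger

text \<open>From time \<open>N\<close> on the rule can fail only at \<open>i\<close>, and it always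
  leads to a vertex above \<open>1\<close>, so \<open>i\<close> is never reached. The rule also
  keeps the parity, which tells whose basin the play ends in.\<close>

lemma mixing_play:
  assumes "i < 2" "p > 0" "\<rho> N \<noteq> i"
    and \<rho>: "\<And>k. N \<le> k \<Longrightarrow> \<rho> k \<noteq> i \<Longrightarrow> \<rho> (Suc k) = (if p dvd Suc (k + s) then 2 else 4) + \<rho> k mod 2"
  defines "c \<equiv> \<rho> N mod 2"
  shows "N \<le> k \<Longrightarrow> \<rho> k mod 2 = c"
    and "mp basin_game c \<rho> = ereal (2 - 2 / p)" "mp basin_game (1 - c) \<rho> = ereal (2 - 1 / p)"
proof -
  have *: "\<rho> k \<noteq> i \<and> \<rho> k mod 2 = c" if "N \<le> k" for k
    using that
  proof (induction k rule: dec_induct)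
    case base
    then show ?case
      using assms by simp
  next
    case (step k)
    then have "\<rho> (Suc k) = (if p dvd Suc (k + s) then 2 else 4) + c"
      using \<rho>[of k] by simp
    then show ?case
      using \<open>i < 2\<close> by (auto simp: c_def four_add_mod_2)
  qed
  then show "N \<le> k \<Longrightarrow> \<rho> k mod 2 = c"
    by blast
  have "\<rho> (Suc k) = (if p dvd Suc (k + s) then 2 else 4) + c" if "N \<le> k" for k
    using \<rho>[OF that] *[OF that] by simp
  moreover have "c < 2"
    by (simp add: c_def)
  ultimately show "mp basin_game c \<rho> = ereal (2 - 2 / p)" "mp basin_game (1 - c) \<rho> = ereal (2 - 1 / p)"
    using mp_mixing[of c p N \<rho> s] \<open>p > 0\<close> by blast+
qed

text \<open>Meant to be followed by all players at once: visiting the low vertex with frequency \<open>1 / p\<close>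
  gives \<open>x = 2 - 2 / p\<close>.\<close>

definition punish :: "nat \<Rightarrow> nat \<Rightarrow> nat list \<Rightarrow> nat" where
  "punish i p h = (if last h = i then 1 - i else (if p dvd length h then 2 else 4) + last h mod 2)"

lemma last_hist_less: "is_hist basin_game h \<Longrightarrow> last h < 6"
  by (metis basin_game_simps(2) is_hist_def last_in_set lessThan_iff subsetD)

lemma strategy_punish:
  assumes "i < 2"
  shows "strategy basin_game q (punish i p)"
  unfolding strategy_def
proof (intro allI impI)
  fix h
  assume "is_hist basin_game h \<and> owner basin_game (last h) = q"
  then have "last h < 6"
    using last_hist_less by blast
  moreover have "last h mod 2 < 2"
    by simp
  ultimately show "(last h, punish i p h) \<in> edges basin_game"
    using assms unfolding punish_def basin_game_simps by (auto simp: four_add_mod_2)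
qed

text \<open>After any history, even one with deviations, the common strategy passes at most once and
  then settles in a basin. Players \<open>0\<close> and \<open>1\<close>, when their vertex is met,
  get at least \<open>2 - 2 / p\<close>.\<close>

lemma punish_rational:
  assumes "i < 2" "p > 0" "v < 6"
    and req: "\<And>v. v < 2 \<Longrightarrow> req v \<le> ereal (2 - 2 / p)" "\<And>v. 2 \<le> v \<Longrightarrow> req v \<le> 0"
  shows "(\<lambda>_. punish i p) \<in> lamRat basin_game req v"
proof -
  have "consistent basin_game req (outcome basin_game (shift_profile (\<lambda>_. punish i p) hu) (last hu))"
    (is "consistent _ _ ?\<rho>") if "is_hist basin_game hu" for hu
  proof -
    \<comment> \<open>The mixing rule does not apply at \<open>i\<close>; a play starting there is
      analysed from the next vertex, \<open>1 - i\<close>.\<close>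
    define N :: nat where "N = (if last hu = i then 1 else 0)"
    define c where "c = ?\<rho> N mod 2"
    \<comment> \<open>Prepending \<open>butlast hu\<close> lengthens the residual history by
      \<open>length hu - 1\<close>, which becomes the phase.\<close>
    have \<rho>: "?\<rho> (Suc k) = (if ?\<rho> k = i then 1 - i
        else (if p dvd Suc (k + (length hu - 1)) then 2 else 4) + ?\<rho> k mod 2)" for k
      unfolding outcome_Suc unfolding shift_profile_def punish_def
      by (simp add: last_outpref add.commute)
    have N: "?\<rho> N \<noteq> i"
      using \<rho>[of 0] \<open>i < 2\<close> by (auto simp: N_def less_2_cases_iff)
    note mix = mixing_play[of i p ?\<rho> N "length hu - 1", OF \<open>i < 2\<close> \<open>p > 0\<close> N, folded c_def]
    have mod: "?\<rho> k mod 2 = c" if "N \<le> k" for k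
      using mix(1) \<rho> that by simp
    have mp: "mp basin_game c ?\<rho> = ereal (2 - 2 / p)" "mp basin_game (1 - c) ?\<rho> = ereal (2 - 1 / p)"
      using mix(2,3) \<rho> by simp_all
    show ?thesis
      unfolding consistent_def mp_basin_game_shift
    proof
      fix n
      \<comment> \<open>The cases are a neutral vertex, the vertex \<open>c\<close> of the player
        whose basin is reached, and \<open>i\<close> before its only pass.\<close>
      consider "2 \<le> ?\<rho> n" | "?\<rho> n < 2" "N \<le> n" | "?\<rho> n < 2" "n < N"
        by linarith
      then show "req (?\<rho> n) \<le> mp basin_game (owner basin_game (?\<rho> n)) ?\<rho>"
      proof cases
        case 1
        then show ?thesis
          using req(2) by (simp add: mp_basin_game_2)
      next
        case 2
        then have "?\<rho> n = c"
          using mod by force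
        then show ?thesis
          using 2 req(1)[of c] mp(1) by simp
      next
        case 3
        then have "n = 0" "N = 1" "?\<rho> 0 = i"
          by (auto simp: N_def split: if_splits)
        then have "1 - c = i" "?\<rho> n = i"
          using \<rho>[of 0] \<open>i < 2\<close> by (auto simp: c_def)
        then have "mp basin_game i ?\<rho> = ereal (2 - 1 / p)"
          using mp(2) by simp
        moreover have "2 - 2 / real p \<le> 2 - 1 / real p"
          using \<open>p > 0\<close> by (simp add: field_simps)
        ultimately show ?thesis
          using \<open>?\<rho> n = i\<close> req(1)[OF \<open>i < 2\<close>] \<open>i < 2\<close> by (auto intro: order_trans)
      qed
    qed
  qed
  then have "rational basin_game req v (\<lambda>_. punish i p)"
    unfolding rational_def Let_def
    using strategy_punish[OF \<open>i < 2\<close>]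
    by (intro exI[of _ "punish i p"]) (auto simp: compatible_def fun_upd_idem)
  then show ?thesis
    using strategy_punish[OF \<open>i < 2\<close>] by (simp add: lamRat_def profile_minus_def)
qed

lemma nego_le:
  assumes "\<sigma>s \<in> lamRat G req v" "v \<in> verts G"
    and "\<And>\<sigma>i. strategy G (owner G v) \<sigma>i \<Longrightarrow> mp G (owner G v) (outcome G (\<sigma>s(owner G v := \<sigma>i)) v) \<le> c"
  shows "nego G req v \<le> c"
proof -
  have "(SUP \<sigma>i \<in> {\<sigma>i. strategy G (owner G v) \<sigma>i}. mp G (owner G v) (outcome G (\<sigma>s(owner G v := \<sigma>i)) v)) \<le> c"
    using assms(3) by (intro SUP_least) blast
  then show ?thesis
    unfolding nego_def Let_def if_P[OF assms(2)] by (rule INF_lower2[OF assms(1)])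
qed

text \<open>A \<open>p\<close> with both requirements at most \<open>2 - 2 / p\<close> makes
  \<open>punish\<close> rational, and \<open>punish\<close> caps player \<open>i\<close> at
  \<open>2 - 1 / p\<close>.\<close>

lemma nego_basin_game_less:
  assumes "i < 2"
    and req: "\<And>v. v < 2 \<Longrightarrow> req v < 2" "\<And>v. 2 \<le> v \<Longrightarrow> req v \<le> 0"
  shows "nego basin_game req i < 2" "2 \<le> v \<Longrightarrow> nego basin_game req v \<le> 0"
proof -
  obtain r where "max (req 0) (req 1) < ereal r" "ereal r < 2"
    using ereal_dense2[of "max (req 0) (req 1)" 2] req(1) by auto
  then have r: "req 0 \<le> ereal r" "req 1 \<le> ereal r" "r < 2"
    by auto
  obtain m where m: "inverse (real (Suc m)) < (2 - r) / 2"
    using reals_Archimedean[of "(2 - r) / 2"] \<open>r < 2\<close> by auto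
  define p where "p = Suc m"
  have "p > 0"
    by (simp add: p_def)
  have "r \<le> 2 - 2 / p"
    using m by (simp add: p_def field_simps)
  then have p: "req v \<le> ereal (2 - 2 / p)" if "v < 2" for v
    using r that by (auto simp: less_2_cases_iff intro: order_trans)
  have rat: "(\<lambda>_. punish i p) \<in> lamRat basin_game req v" if "v < 6" for v
    by (rule punish_rational) (use assms p that \<open>p > 0\<close> in auto)
  \<comment> \<open>Player \<open>2\<close> gets \<open>0\<close> in every play, but without a
    rational profile the infimum would be infinite; this is why \<open>rat\<close> covers the
    neutral vertices.\<close>
  show "nego basin_game req v \<le> 0" if "2 \<le> v"
  proof (cases "v < 6")
    case True
    then show ?thesis
      using that by (intro nego_le[OF rat]) (auto simp: mp_basin_game_2)
  next
    case False
    then show ?thesis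
      by (simp add: nego_def)
  qed
  have "nego basin_game req i \<le> ereal (2 - 1 / p)"
  proof (rule nego_le[OF rat])
    fix \<sigma>i
    assume "strategy basin_game (owner basin_game i) \<sigma>i"
    then have \<sigma>i: "strategy basin_game i \<sigma>i"
      using \<open>i < 2\<close> by simp
    define \<rho> where "\<rho> = outcome basin_game ((\<lambda>_. punish i p)(i := \<sigma>i)) i"
    have "(\<rho> 0, \<rho> (Suc 0)) \<in> edges basin_game"
      unfolding \<rho>_def
      by (rule outcome_edge[OF mean_payoff_basin_game]) (use \<sigma>i \<open>i < 2\<close> strategy_punish in auto)
    moreover have "\<rho> 0 = i"
      by (simp add: \<rho>_def)
    \<comment> \<open>There is no loop at \<open>i\<close>, so \<open>\<sigma>i\<close> decides only
      the first move: entering the own basin yields \<open>2 - 2 / p\<close>, passing yields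
      \<open>2 - 1 / p\<close>.\<close>
    ultimately have "\<rho> 1 \<noteq> i"
      using \<open>i < 2\<close> by (auto simp: less_2_cases_iff)
    moreover have "\<rho> (Suc k) = (if p dvd Suc (k + 0) then 2 else 4) + \<rho> k mod 2" if "\<rho> k \<noteq> i" for k
      using that \<open>i < 2\<close> by (simp add: \<rho>_def outcome_Suc punish_def last_outpref)
    ultimately have "mp basin_game (\<rho> 1 mod 2) \<rho> = ereal (2 - 2 / p)"
      "mp basin_game (1 - \<rho> 1 mod 2) \<rho> = ereal (2 - 1 / p)"
      using mixing_play[of i p \<rho> 1 0] \<open>i < 2\<close> \<open>p > 0\<close> by blast+
    moreover have "i = \<rho> 1 mod 2 \<or> i = 1 - \<rho> 1 mod 2"
      using \<open>i < 2\<close> by (auto simp: less_2_cases_iff)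
    moreover have "2 - 2 / real p \<le> 2 - 1 / real p"
      using \<open>p > 0\<close> by (simp add: field_simps)
    ultimately have "mp basin_game i \<rho> \<le> ereal (2 - 1 / p)"
      by auto
    then show "mp basin_game (owner basin_game i)
        (outcome basin_game ((\<lambda>_. punish i p)(owner basin_game i := \<sigma>i)) i) \<le> ereal (2 - 1 / p)"
      using \<open>i < 2\<close> by (simp add: \<rho>_def)
  qed (use \<open>i < 2\<close> in auto)
  also have "\<dots> < 2"
    using \<open>p > 0\<close> by (simp add: numeral_eq_ereal)
  finally show "nego basin_game req i < 2" .
qed

subsection \<open>Lower bound\<close>

lemma le_nego:
  assumes "v \<in> verts G" "strategy G (owner G v) \<sigma>i"
    and "\<And>\<sigma>s. \<sigma>s \<in> lamRat G req v \<Longrightarrow> c \<le> mp G (owner G v) (outcome G (\<sigma>s(owner G v := \<sigma>i)) v)"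
  shows "c \<le> nego G req v"
  unfolding nego_def Let_def if_P[OF assms(1)]
  by (intro INF_greatest SUP_upper2[of \<sigma>i]) (use assms in auto)

lemma strategy_hand_over:
  assumes "i < 2"
  shows "strategy basin_game i (\<lambda>_. 1 - i)"
  unfolding strategy_def
proof (intro allI impI)
  fix h
  assume "is_hist basin_game h \<and> owner basin_game (last h) = i"
  then have "last h = i"
    using assms by (auto split: if_splits)
  then show "(last h, 1 - i) \<in> edges basin_game"
    using assms by auto
qed

lemma nego_basin_game_nonneg:
  assumes "i < 2"
  shows "0 \<le> nego basin_game req i"
  by (rule le_nego[where \<sigma>i = "\<lambda>_. 1 - i"])
    (use assms strategy_hand_over[OF assms] in \<open>simp_all add: mp_basin_game_nonneg\<close>)

text \<open>Player \<open>i\<close> never moves from time \<open>n\<close> on, so replacing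
  \<open>\<sigma>i\<close> by \<open>\<tau>\<close> changes nothing. This carries consistency from
  the unknown witness of rationality over to the actual play.\<close>

lemma residual_outcome:
  assumes "\<And>m. owner G (outcome G (\<sigma>s(i := \<sigma>i)) v (n + m)) \<noteq> i"
  defines "hu \<equiv> outpref G (\<sigma>s(i := \<sigma>i)) v n"
  shows "outcome G (shift_profile (\<sigma>s(i := \<tau>)) hu) (last hu) m = outcome G (\<sigma>s(i := \<sigma>i)) v (n + m)"
proof -
  let ?\<sigma> = "\<sigma>s(i := \<sigma>i)" and ?\<sigma>' = "shift_profile (\<sigma>s(i := \<tau>)) hu"
  \<comment> \<open>The last vertex of \<open>hu\<close> is also the first of the residual play,
    hence \<open>butlast\<close>.\<close>
  have "butlast hu @ outpref G ?\<sigma>' (last hu) m = outpref G ?\<sigma> v (n + m)" for m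
  proof (induction m)
    case 0
    then show ?case
      by (simp add: hu_def del: fun_upd_apply)
  next
    case (Suc m)
    have last: "outcome G ?\<sigma>' (last hu) m = outcome G ?\<sigma> v (n + m)"
      using arg_cong[OF Suc, of last] by (simp add: outcome_def del: fun_upd_apply)
    have "?\<sigma>' q h = ?\<sigma> q (butlast hu @ h)" if "q \<noteq> i" for q h
      using that by (simp add: shift_profile_def)
    from this[OF assms(1)] have "outcome G ?\<sigma>' (last hu) (Suc m) = outcome G ?\<sigma> v (Suc (n + m))"
      by (simp only: outcome_Suc last Suc)
    with Suc show ?case
      by (simp only: outpref_Suc add_Suc_right flip: append_assoc)
  qed
  from arg_cong[OF this, of last m] show ?thesis
    by (simp add: outcome_def del: fun_upd_apply)
qed

lemma nego_basin_game_ge: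
  assumes "i < 2" and req: "req (1 - i) \<le> 2"
  shows "1 + ereal (1/2) * req (1 - i) \<le> nego basin_game req i"
proof (rule le_nego)
  show "i \<in> verts basin_game"
    using assms by simp
  show "strategy basin_game (owner basin_game i) (\<lambda>_. 1 - i)"
    using assms strategy_hand_over by simp
  fix \<sigma>s
  assume "\<sigma>s \<in> lamRat basin_game req i"
  then have \<sigma>s: "profile_minus basin_game i \<sigma>s" "rational basin_game req i \<sigma>s"
    using \<open>i < 2\<close> by (simp_all add: lamRat_def)
  define \<rho> where "\<rho> = outcome basin_game (\<sigma>s(i := \<lambda>_. 1 - i)) i"
  have edge: "(\<rho> k, \<rho> (Suc k)) \<in> edges basin_game" for k
    unfolding \<rho>_def
    by (rule outcome_edge[OF mean_payoff_basin_game])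
      (use \<sigma>s(1) strategy_hand_over \<open>i < 2\<close> in \<open>auto simp: profile_minus_def\<close>)
  have hand_over: "\<rho> (Suc k) = 1 - i" if "\<rho> k = i" for k
    using that \<open>i < 2\<close> by (simp add: \<rho>_def outcome_Suc)
  have "1 + ereal (1/2) * req (1 - i) \<le> mp basin_game i \<rho>"
  proof (cases "\<forall>k. \<rho> k < 2")
    case True
    then have "\<rho> k \<noteq> 2 + i \<and> \<rho> k \<noteq> 3 - i" for k
      using \<open>i < 2\<close> by (auto simp: less_2_cases_iff dest: spec[of _ k])
    then have "mp basin_game i \<rho> = ereal 2"
      using \<open>i < 2\<close> by (intro mp_const) auto
    then show ?thesis
      using req by (cases "req (1 - i)") (auto simp: one_ereal_def numeral_eq_ereal)
  next
    case False
    \<comment> \<open>A basin is first entered at time \<open>m = Suc n\<close>; since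
      \<open>i\<close> always passes, the vertex left at time \<open>n\<close> is
      \<open>1 - i\<close>.\<close>
    then obtain m where m: "\<not> \<rho> m < 2" and less: "\<And>k. k < m \<Longrightarrow> \<rho> k < 2"
      using exists_least_iff[of "\<lambda>k. \<not> \<rho> k < 2"] by blast
    moreover have "\<rho> 0 = i"
      by (simp add: \<rho>_def)
    ultimately obtain n where n: "m = Suc n"
      using \<open>i < 2\<close> by (cases m) auto
    have "\<rho> n \<noteq> i"
      using hand_over[of n] m n by auto
    then have \<rho>_n: "\<rho> n = 1 - i"
      using less[of n] n \<open>i < 2\<close> by auto
    have basin: "2 \<le> \<rho> (n + Suc k) \<and> \<rho> (n + Suc k) < 6 \<and> \<rho> (n + Suc k) mod 2 = 1 - i" for k
    proof (induction k)
      case 0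
      then show ?case
        using edge[of n] m n \<rho>_n \<open>i < 2\<close> by auto
    next
      case (Suc k)
      then show ?case
        using edge[of "n + Suc k"] by auto
    qed
    \<comment> \<open>These are the vertex of player \<open>1 - i\<close> and the low and high
      vertices of the basin of that player.\<close>
    have basin': "\<rho> (n + k) \<in> {1 - i, 3 - i, 5 - i}" for k
    proof (cases k)
      case 0
      then show ?thesis
        using \<rho>_n by simp
    next
      case (Suc l)
      have "x \<in> {2, 3, 4, 5}" if "2 \<le> x" "x < 6" for x :: nat
        using that by auto
      then show ?thesis
        using basin[of l] Suc \<open>i < 2\<close> by (fastforce simp: less_2_cases_iff)
    qed
    \<comment> \<open>This history ends at \<open>1 - i\<close>, so rationality imposes the
      requirement there on the residual play.\<close>
    define hu where "hu = outpref basin_game (\<sigma>s(i := \<lambda>_. 1 - i)) i n"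
    have "compatible basin_game i \<sigma>s i hu"
      unfolding hu_def using \<sigma>s(1) \<open>i < 2\<close> strategy_hand_over
      by (intro compatible_outpref mean_payoff_basin_game) auto
    then obtain \<tau> where cons:
      "consistent basin_game req (outcome basin_game (shift_profile (\<sigma>s(i := \<tau>)) hu) (last hu))"
      using \<sigma>s(2) \<open>i < 2\<close> by (auto simp: rational_def Let_def)
    have "owner basin_game (\<rho> (n + k)) \<noteq> i" for k
      using basin'[of k] \<open>i < 2\<close> by (auto simp: less_2_cases_iff)
    then have "outcome basin_game (shift_profile (\<sigma>s(i := \<tau>)) hu) (last hu) = (\<lambda>k. \<rho> (n + k))"
      unfolding hu_def \<rho>_def by (intro ext residual_outcome)
    with cons have "consistent basin_game req (\<lambda>k. \<rho> (n + k))"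
      by simp
    then have "req (\<rho> (n + 0)) \<le> mp basin_game (owner basin_game (\<rho> (n + 0))) (\<lambda>k. \<rho> (n + (0 + k)))"
      unfolding consistent_def by (rule spec)
    then have "req (1 - i) \<le> mp basin_game (1 - i) (\<lambda>k. \<rho> (n + k))"
      using \<rho>_n \<open>i < 2\<close> by (simp split: if_splits)
    then have "1 + ereal (1/2) * req (1 - i) \<le> 1 + ereal (1/2) * mp basin_game (1 - i) (\<lambda>k. \<rho> (n + k))"
      by (intro add_left_mono ereal_mult_left_mono) auto
    also have "\<dots> = mp basin_game i (\<lambda>k. \<rho> (n + k))"
    proof (rule mp_affine[symmetric])
      have "real_of_rat (reward basin_game i (v, w)) = 1 + real_of_rat (reward basin_game (1 - i) (v, w)) / 2"
        if "v \<in> {1 - i, 3 - i, 5 - i}" for v w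
        using that \<open>i < 2\<close> by (auto simp: less_2_cases_iff)
      then show "real_of_rat (reward basin_game i (\<rho> (n + k), \<rho> (n + Suc k)))
          = 1 + real_of_rat (reward basin_game (1 - i) (\<rho> (n + k), \<rho> (n + Suc k))) / 2" for k
        using basin' by blast
    qed
    finally show ?thesis
      unfolding mp_basin_game_shift .
  qed
  then show "1 + ereal (1/2) * req (1 - i)
      \<le> mp basin_game (owner basin_game i) (outcome basin_game (\<sigma>s(owner basin_game i := \<lambda>_. 1 - i)) i)"
    using \<open>i < 2\<close> by (simp add: \<rho>_def)
qed

theorem mainTheorem5:
  shows "\<exists>G. mean_payoff_game G \<and>
    \<not> (\<exists>N. \<forall>n\<ge>N. \<forall>v\<in>verts G. (nego G ^^ n) lam0 v = (nego G ^^ N) lam0 v)"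
proof (intro exI conjI notI)
  show "mean_payoff_game basin_game"
    by (rule mean_payoff_basin_game)
  let ?l = "\<lambda>n. (nego basin_game ^^ n) lam0"
  have bound: "(\<forall>v<2. ?l n v < 2) \<and> (\<forall>v\<ge>2. ?l n v \<le> 0)" for n
  proof (induction n)
    case 0
    then show ?case
      by (simp add: lam0_def)
  next
    case (Suc n)
    have "nego basin_game (?l n) v < 2" if "v < 2" for v
      using Suc that by (intro nego_basin_game_less(1)) blast+
    moreover have "nego basin_game (?l n) v \<le> 0" if "2 \<le> v" for v
      using Suc that by (intro nego_basin_game_less(2)[of 0]) auto
    ultimately show ?case
      by simp
  qed
  assume "\<exists>N. \<forall>n\<ge>N. \<forall>v\<in>verts basin_game. ?l n v = ?l N v"
  then obtain N where N: "\<And>n v. N \<le> n \<Longrightarrow> v < 6 \<Longrightarrow> ?l n v = ?l N v"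
    by auto
  have fixed: "nego basin_game (?l N) v = ?l N v" if "v < 6" for v
    using N[of "Suc N" v] that by simp
  \<comment> \<open>Adding the last inequality for both vertices gives a sum of at least
    \<open>4\<close>, against the strict bounds. Nonnegativity rules out the value
    \<open>-\<infinity>\<close>, for which these inequalities hold trivially.\<close>
  have "0 \<le> ?l N v" "?l N v < 2" "1 + ereal (1/2) * ?l N (1 - v) \<le> ?l N v" if "v < 2" for v
    using fixed[of v] that bound[of N] nego_basin_game_nonneg[of v "?l N"]
      nego_basin_game_ge[of v "?l N"]
    by (auto simp: less_imp_le)
  from this[of 0] this[of 1] show False
    by (cases "?l N 0"; cases "?l N 1") (auto simp: one_ereal_def numeral_eq_ereal)
qed

end
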